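(* Let $\mathcal{A}=(L,E,R,\partial_1,\partial_2,\{,\})$ and $\mathcal{A}'=(L',E',R',\partial_1',\partial_2',\{,\})$ be 2-crossed modules of commutative algebras, let $f=(f_2,f_1,f_0)\colon\mathcal{A}\to\mathcal{A}'$ be a 2-crossed module morphism, and let $(s,t)$ be a quadratic $f$-derivation. Define $g=(g_2,g_1,g_0)$ by $$g_0(r)=f_0(r)+(\partial_1'\circ s)(r),\quad g_1(e)=f_1(e)+(s\circ\partial_1)(e)+(\partial_2'\circ t)(e),\quad g_2(l)=f_2(l)+(t\circ\partial_2)(l)$$ for $r\in R$, $e\in E$, $l\in L$. Then $g$ is also a 2-crossed module map $\mathcal{A}\to\mathcal{A}'$.
   Context: Conventions. $\kappa$ is a fixed commutative ring. All algebras are commutative associative $\kappa$-algebras, not assumed unital; algebra maps are $\kappa$-linear multiplicative maps. An action of an algebra $R$ on an algebra $M$ is a $\kappa$-bilinear map $(r,m)\mapsto r\blacktriangleright m\in M$ with $r\blacktriangleright(mm')=(r\blacktriangleright m)m'=m(r\blacktriangleright m')$ and $(rr')\blacktriangleright m=r\blacktriangleright(r'\blacktriangleright m)$. 2-crossed modules. A 2-crossed module $(L,E,R,\partial_1,\partial_2,\{,\})$ consists of algebra maps $L\xrightarrow{\partial_2}E\xrightarrow{\partial_1}R$ with $\partial_1\partial_2=0$, actions $\blacktriangleright$ of $R$ on $E$ and on $L$ with $\partial_1(r\blacktriangleright e)=r\,\partial_1(e)$ and $\partial_2(r\blacktriangleright l)=r\blacktriangleright\partial_2(l)$, and an $R$-bilinear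 Peiffer lifting $\{\,\otimes\,\}\colon E\otimes_R E\to L$ such that, writing $e\blacktriangleright' l:=\{e\otimes\partial_2(l)\}$ (this is an action of $E$ on $L$), for all $e,e',e''\in E$, $l,l'\in L$, $r\in R$: $\partial_2\{e\otimes e'\}=ee'-\partial_1(e')\blacktriangleright e$; $\{\partial_2(l)\otimes\partial_2(l')\}=ll'$; $\{e\otimes e'e''\}=\{ee'\otimes e''\}+\partial_1(e'')\blacktriangleright\{e\otimes e'\}$; $\{\partial_2(l)\otimes e\}=e\blacktriangleright' l-\partial_1(e)\blacktriangleright l$; $r\blacktriangleright\{e\otimes e'\}=\{r\blacktriangleright e\otimes e'\}=\{e\otimes r\blacktriangleright e'\}$. Maps. A 2-crossed module map $f=(f_2,f_1,f_0)\colon\mathcal{A}\to\mathcal{A}'$ consists of algebra maps $f_2\colon L\to L'$, $f_1\colon E\to E'$, $f_0\colon R\to R'$ with $\partial_2'f_2=f_1\partial_2$, $\partial_1'f_1=f_0\partial_1$, $f_1(r\blacktriangleright e)=f_0(r)\blacktriangleright f_1(e)$, $f_2(r\blacktriangleright l)=f_0(r)\blacktriangleright f_2(l)$, $f_2\{e\otimes e'\}=\{f_1(e)\otimes f_1(e')\}$. Quadratic derivations. A quadratic $f$-derivation is a pair $(s,t)$ of $\kappa$-linear maps $s\colon R\to E'$, $t\colon E\to L'$ such that for all $r,r'\in R$, $e,e'\in E$: $s(rr')=f_0(r)\blacktriangleright s(r')+f_0(r')\blacktriangleright s(r)+s(r)s(r')$, $t(ee')=\{s\partial_1(e)\otimes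 f_1(e')\}+\{s\partial_1(e')\otimes f_1(e)\}+f_1(e)\blacktriangleright' t(e')+f_1(e')\blacktriangleright' t(e)+s\partial_1(e)\blacktriangleright' t(e')+s\partial_1(e')\blacktriangleright' t(e)+t(e)t(e')$, $t(r\blacktriangleright e)=f_0(r)\blacktriangleright t(e)+\partial_1's(r)\blacktriangleright t(e)+\{s(r)\otimes f_1(e)\}-\{f_1(e)\otimes s(r)\}-\{s\partial_1(e)\otimes s(r)\}$. *)

theory Defs
  imports Complex_Main
begin

text \<open>
  Algebras are whole types of class \<^class>\<open>comm_ring\<close>, which does not require a unit, together
  with a scalar multiplication. The ground ring has sort \<open>{comm_ring, comm_monoid_mult}\<close>, i.e.
  commutative with unit. The class \<^class>\<open>comm_ring_1\<close>, and with it the locale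
  \<^locale>\<open>module\<close>, would in addition exclude the zero ring.
\<close>

locale k_algebra =
  fixes scale :: "'k::{comm_ring,comm_monoid_mult} \<Rightarrow> 'a::comm_ring \<Rightarrow> 'a"
  assumes scale_add_right: "scale c (x + y) = scale c x + scale c y"
    and scale_add_left: "scale (c + d) x = scale c x + scale d x"
    and scale_scale: "scale c (scale d x) = scale (c * d) x"
    and scale_one: "scale 1 x = x"
    and scale_mult: "scale c (x * y) = scale c x * y"

lemma k_algebra_module:
  fixes scale :: "'k::comm_ring_1 \<Rightarrow> 'a::comm_ring \<Rightarrow> 'a"
  assumes "k_algebra scale"
  shows "module scale"
proof -
  interpret k_algebra scale by fact
  show ?thesis
    by unfold_locales (simp_all add: scale_add_right scale_add_left scale_scale scale_one)
qed

locale k_linear =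
  fixes scale1 :: "'k::{comm_ring,comm_monoid_mult} \<Rightarrow> 'a::comm_ring \<Rightarrow> 'a"
    and scale2 :: "'k \<Rightarrow> 'b::comm_ring \<Rightarrow> 'b"
    and f :: "'a \<Rightarrow> 'b"
  assumes add: "f (x + y) = f x + f y"
    and scale: "f (scale1 c x) = scale2 c (f x)"

locale algebra_map = k_linear +
  assumes mult: "f (x * y) = f x * f y"

locale k_bilinear =
  fixes scale1 :: "'k::{comm_ring,comm_monoid_mult} \<Rightarrow> 'a::comm_ring \<Rightarrow> 'a"
    and scale2 :: "'k \<Rightarrow> 'b::comm_ring \<Rightarrow> 'b"
    and scale3 :: "'k \<Rightarrow> 'c::comm_ring \<Rightarrow> 'c"
    and b :: "'a \<Rightarrow> 'b \<Rightarrow> 'c"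
  assumes linear_left: "k_linear scale1 scale3 (\<lambda>x. b x y)"
    and linear_right: "k_linear scale2 scale3 (\<lambda>y. b x y)"

locale algebra_action = k_bilinear scaleR scaleM scaleM act
  for scaleR :: "'k::{comm_ring,comm_monoid_mult} \<Rightarrow> 'r::comm_ring \<Rightarrow> 'r"
    and scaleM :: "'k \<Rightarrow> 'm::comm_ring \<Rightarrow> 'm"
    and act :: "'r \<Rightarrow> 'm \<Rightarrow> 'm" +
  assumes act_mult_left: "act r (m * m') = act r m * m'"
    and act_mult_right: "act r (m * m') = m * act r m'"
    and act_act: "act (r * r') m = act r (act r' m)"

record ('k, 'l, 'e, 'r) two_crossed =
  scale_L :: "'k \<Rightarrow> 'l \<Rightarrow> 'l"
  scale_E :: "'k \<Rightarrow> 'e \<Rightarrow> 'e"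
  scale_R :: "'k \<Rightarrow> 'r \<Rightarrow> 'r"
  bd2 :: "'l \<Rightarrow> 'e"
  bd1 :: "'e \<Rightarrow> 'r"
  act_E :: "'r \<Rightarrow> 'e \<Rightarrow> 'e"
  act_L :: "'r \<Rightarrow> 'l \<Rightarrow> 'l"
  peiffer :: "'e \<Rightarrow> 'e \<Rightarrow> 'l"

definition act_EL :: "('k, 'l, 'e, 'r) two_crossed \<Rightarrow> 'e \<Rightarrow> 'l \<Rightarrow> 'l"
  where "act_EL A e l = peiffer A e (bd2 A l)"

text \<open>
  An \<open>R\<close>-bilinear map \<open>E \<otimes>\<^sub>R E \<rightarrow> L\<close> is given by the corresponding map of two arguments. As \<open>R\<close>
  need not have a unit, linearity over the ground ring is a separate requirement; the two
  \<open>act_peiffer\<close> axioms say that the map is balanced over \<open>R\<close> and \<open>R\<close>-linear.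
\<close>

locale two_crossed_module =
  fixes A :: "('k::{comm_ring,comm_monoid_mult}, 'l::comm_ring, 'e::comm_ring, 'r::comm_ring) two_crossed"
  assumes algebra_L: "k_algebra (scale_L A)"
    and algebra_E: "k_algebra (scale_E A)"
    and algebra_R: "k_algebra (scale_R A)"
    and map_bd2: "algebra_map (scale_L A) (scale_E A) (bd2 A)"
    and map_bd1: "algebra_map (scale_E A) (scale_R A) (bd1 A)"
    and bd1_bd2: "bd1 A (bd2 A l) = 0"
    and action_E: "algebra_action (scale_R A) (scale_E A) (act_E A)"
    and action_L: "algebra_action (scale_R A) (scale_L A) (act_L A)"
    and bd1_act: "bd1 A (act_E A r e) = r * bd1 A e"
    and bd2_act: "bd2 A (act_L A r l) = act_E A r (bd2 A l)"
    and bilinear_peiffer: "k_bilinear (scale_E A) (scale_E A) (scale_L A) (peiffer A)"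
    and bd2_peiffer: "bd2 A (peiffer A e e') = e * e' - act_E A (bd1 A e') e"
    and peiffer_bd2_bd2: "peiffer A (bd2 A l) (bd2 A l') = l * l'"
    and peiffer_mult:
      "peiffer A e (e' * e'') = peiffer A (e * e') e'' + act_L A (bd1 A e'') (peiffer A e e')"
    and peiffer_bd2: "peiffer A (bd2 A l) e = act_EL A e l - act_L A (bd1 A e) l"
    and act_peiffer_left: "act_L A r (peiffer A e e') = peiffer A (act_E A r e) e'"
    and act_peiffer_right: "act_L A r (peiffer A e e') = peiffer A e (act_E A r e')"

text \<open>That \<^const>\<open>act_EL\<close> is an action follows from the axioms.\<close>

lemma (in two_crossed_module) action_EL:
  "algebra_action (scale_E A) (scale_L A) (act_EL A)"
proof -
  interpret b2: algebra_map "scale_L A" "scale_E A" "bd2 A" by (rule map_bd2)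
  interpret P: k_bilinear "scale_E A" "scale_E A" "scale_L A" "peiffer A" by (rule bilinear_peiffer)
  interpret aE: algebra_action "scale_R A" "scale_E A" "act_E A" by (rule action_E)
  interpret aL: algebra_action "scale_R A" "scale_L A" "act_L A" by (rule action_L)
  have 0: "act_E A 0 e = 0" for e
    using k_linear.add[OF aE.linear_left, of 0 0 e] by simp
  have 1: "act_L A 0 l = 0" for l
    using k_linear.add[OF aL.linear_left, of 0 0 l] by simp
  have m: "act_EL A e (l * l') = act_EL A e l * l'" for e l l'
    by (simp add: act_EL_def b2.mult peiffer_mult bd1_bd2 0 1 bd2_peiffer
        flip: peiffer_bd2_bd2)
  show ?thesis
  proof (intro algebra_action.intro k_bilinear.intro algebra_action_axioms.intro)
    show "k_linear (scale_E A) (scale_L A) (\<lambda>x. act_EL A x y)" for y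
      using P.linear_left by (simp add: act_EL_def)
    show "k_linear (scale_L A) (scale_L A) (\<lambda>y. act_EL A x y)" for x
      by unfold_locales
        (simp_all add: act_EL_def b2.add b2.scale k_linear.add[OF P.linear_right]
          k_linear.scale[OF P.linear_right])
    show "act_EL A e (l * l') = act_EL A e l * l'" for e l l' by (rule m)
    show "act_EL A e (l * l') = l * act_EL A e l'" for e l l'
      using m[of e l' l] by (simp add: mult.commute)
    show "act_EL A (e * e') l = act_EL A e (act_EL A e' l)" for e e' l
      by (simp add: act_EL_def bd2_peiffer bd1_bd2 0 1 peiffer_mult)
  qed
qed

locale two_crossed_map =
  fixes A :: "('k::{comm_ring,comm_monoid_mult}, 'l::comm_ring, 'e::comm_ring, 'r::comm_ring) two_crossed"
    and A' :: "('k, 'l1::comm_ring, 'e1::comm_ring, 'r1::comm_ring) two_crossed"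
    and f2 :: "'l \<Rightarrow> 'l1" and f1 :: "'e \<Rightarrow> 'e1" and f0 :: "'r \<Rightarrow> 'r1"
  assumes map_f2: "algebra_map (scale_L A) (scale_L A') f2"
    and map_f1: "algebra_map (scale_E A) (scale_E A') f1"
    and map_f0: "algebra_map (scale_R A) (scale_R A') f0"
    and bd2_f2: "bd2 A' (f2 l) = f1 (bd2 A l)"
    and bd1_f1: "bd1 A' (f1 e) = f0 (bd1 A e)"
    and f1_act: "f1 (act_E A r e) = act_E A' (f0 r) (f1 e)"
    and f2_act: "f2 (act_L A r l) = act_L A' (f0 r) (f2 l)"
    and f2_peiffer: "f2 (peiffer A e e') = peiffer A' (f1 e) (f1 e')"

text \<open>The component \<open>f\<^sub>2\<close> does not enter the defining equations of a quadratic \<open>f\<close>-derivation.\<close>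

locale quadratic_derivation =
  fixes A :: "('k::{comm_ring,comm_monoid_mult}, 'l::comm_ring, 'e::comm_ring, 'r::comm_ring) two_crossed"
    and A' :: "('k, 'l1::comm_ring, 'e1::comm_ring, 'r1::comm_ring) two_crossed"
    and f1 :: "'e \<Rightarrow> 'e1" and f0 :: "'r \<Rightarrow> 'r1"
    and s :: "'r \<Rightarrow> 'e1" and t :: "'e \<Rightarrow> 'l1"
  assumes linear_s: "k_linear (scale_R A) (scale_E A') s"
    and linear_t: "k_linear (scale_E A) (scale_L A') t"
    and s_mult: "s (r * r') = act_E A' (f0 r) (s r') + act_E A' (f0 r') (s r) + s r * s r'"
    and t_mult: "t (e * e') =
        peiffer A' (s (bd1 A e)) (f1 e') + peiffer A' (s (bd1 A e')) (f1 e)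
        + act_EL A' (f1 e) (t e') + act_EL A' (f1 e') (t e)
        + act_EL A' (s (bd1 A e)) (t e') + act_EL A' (s (bd1 A e')) (t e)
        + t e * t e'"
    and t_act: "t (act_E A r e) =
        act_L A' (f0 r) (t e) + act_L A' (bd1 A' (s r)) (t e)
        + peiffer A' (s r) (f1 e) - peiffer A' (f1 e) (s r)
        - peiffer A' (s (bd1 A e)) (s r)"

end

theory Submission
  imports Defs
begin

text \<open>
  Each component of \<open>g\<close> is \<open>f\<close> plus a correction, and the derivation rules are the conditions
  under which the correction absorbs the cross terms. In degrees \<open>0\<close> and \<open>1\<close> this is seen by
  applying \<open>\<partial>\<^sub>1\<close> to the rule for \<open>s\<close> and \<open>\<partial>\<^sub>2\<close> to the rules for \<open>t\<close>. The axiom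
  \<open>\<partial>\<^sub>2{x \<otimes> y} = xy - \<partial>\<^sub>1(y) \<triangleright> x\<close> turns a Peiffer term into a product in \<open>E'\<close> minus
  an action term. In \<open>g\<^sub>1(ee')\<close> the products are the cross terms of \<open>f\<^sub>1\<close> and
  \<open>s\<partial>\<^sub>1\<close>, while the action terms cancel the ones produced by \<open>s(\<partial>\<^sub>1(e)\<partial>\<^sub>1(e'))\<close>. In
  \<open>g\<^sub>1(r \<triangleright> e)\<close> it is the products that cancel, by commutativity, and the action terms
  supply the part \<open>\<partial>\<^sub>1's(r) \<triangleright> g\<^sub>1(e)\<close>.

  On \<open>L\<close> the correction is \<open>t\<partial>\<^sub>2\<close>, so every term containing \<open>s\<partial>\<^sub>1\<close> vanishes because
  \<open>\<partial>\<^sub>1\<partial>\<^sub>2 = 0\<close>. What remains is rewritten by the two axioms that give the Peiffer lifting on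
  boundaries, \<open>{\<partial>\<^sub>2(l) \<otimes> \<partial>\<^sub>2(l')} = ll'\<close> and
  \<open>{\<partial>\<^sub>2(l) \<otimes> x} = x \<triangleright>' l - \<partial>\<^sub>1(x) \<triangleright> l\<close>.

  The Peiffer lifting itself is preserved because \<open>t\<close> is applied to
  \<open>\<partial>\<^sub>2{e \<otimes> e'} = ee' - \<partial>\<^sub>1(e') \<triangleright> e\<close>: the difference of the product rule and the action
  rule for \<open>t\<close> is exactly the part of \<open>{g\<^sub>1(e) \<otimes> g\<^sub>1(e')}\<close> that exceeds
  \<open>{f\<^sub>1(e) \<otimes> f\<^sub>1(e')}\<close>, once that is expanded bilinearly into nine terms.
\<close>

context k_linear
begin

lemma zero: "f 0 = 0"
  using add[of 0 0] by simp

lemma diff: "f (x - y) = f x - f y"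
  using add[of "x - y" y] by (simp add: algebra_simps)

end

lemma k_linear_compose:
  assumes "k_linear s1 s2 f" and "k_linear s2 s3 g"
  shows "k_linear s1 s3 (g \<circ> f)"
  using assms by (simp add: k_linear_def)

lemma k_linear_plus:
  assumes "k_algebra s2" and "k_linear s1 s2 f" and "k_linear s1 s2 g"
  shows "k_linear s1 s2 (\<lambda>x. f x + g x)"
  using assms by (simp add: k_linear_def k_algebra.scale_add_right algebra_simps)

context k_bilinear
begin

lemma add_left: "b (x + x') y = b x y + b x' y"
  by (rule k_linear.add[OF linear_left])

lemma add_right: "b x (y + y') = b x y + b x y'"
  by (rule k_linear.add[OF linear_right])

lemma zero_left: "b 0 y = 0"
  by (rule k_linear.zero[OF linear_left])

end

context two_crossed_module
begin

text \<open>
  The correction term of the Peiffer axiom disappears on \<open>{e \<otimes> \<partial>\<^sub>2(l)}\<close> because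
  \<open>\<partial>\<^sub>1\<partial>\<^sub>2 = 0\<close>, so \<open>\<partial>\<^sub>2\<close> is equivariant for the derived action of \<open>E\<close>.
\<close>

lemma bd2_act_EL: "bd2 A (act_EL A e l) = e * bd2 A l"
  by (simp add: act_EL_def bd2_peiffer bd1_bd2
      k_bilinear.zero_left[OF algebra_action.axioms(1)[OF action_E]])

lemma act_EL_bd2: "act_EL A (bd2 A l) l' = l * l'"
  by (simp add: act_EL_def peiffer_bd2_bd2)

end

locale quadratic_homotopy =
  src: two_crossed_module A + tgt: two_crossed_module A' +
  two_crossed_map A A' f2 f1 f0 + quadratic_derivation A A' f1 f0 s t
  for A :: "('k::{comm_ring,comm_monoid_mult}, 'l::comm_ring, 'e::comm_ring, 'r::comm_ring) two_crossed"
    and A' :: "('k, 'l1::comm_ring, 'e1::comm_ring, 'r1::comm_ring) two_crossed"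
    and f2 f1 f0 s t
begin

sublocale b2: algebra_map "scale_L A" "scale_E A" "bd2 A" by (rule src.map_bd2)
sublocale b1: algebra_map "scale_E A" "scale_R A" "bd1 A" by (rule src.map_bd1)
sublocale b2': algebra_map "scale_L A'" "scale_E A'" "bd2 A'" by (rule tgt.map_bd2)
sublocale b1': algebra_map "scale_E A'" "scale_R A'" "bd1 A'" by (rule tgt.map_bd1)
sublocale aE: algebra_action "scale_R A'" "scale_E A'" "act_E A'" by (rule tgt.action_E)
sublocale aL: algebra_action "scale_R A'" "scale_L A'" "act_L A'" by (rule tgt.action_L)
sublocale P: k_bilinear "scale_E A'" "scale_E A'" "scale_L A'" "peiffer A'"
  by (rule tgt.bilinear_peiffer)
sublocale EL: algebra_action "scale_E A'" "scale_L A'" "act_EL A'" by (rule tgt.action_EL)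
sublocale F2: algebra_map "scale_L A" "scale_L A'" f2 by (rule map_f2)
sublocale F1: algebra_map "scale_E A" "scale_E A'" f1 by (rule map_f1)
sublocale F0: algebra_map "scale_R A" "scale_R A'" f0 by (rule map_f0)
sublocale S: k_linear "scale_R A" "scale_E A'" s by (rule linear_s)
sublocale T: k_linear "scale_E A" "scale_L A'" t by (rule linear_t)

definition g0 where "g0 r = f0 r + bd1 A' (s r)"
definition g1 where "g1 e = f1 e + s (bd1 A e) + bd2 A' (t e)"
definition g2 where "g2 l = f2 l + t (bd2 A l)"

lemma linear_g0: "k_linear (scale_R A) (scale_R A') g0"
  using k_linear_plus[OF tgt.algebra_R F0.k_linear_axioms
      k_linear_compose[OF linear_s b1'.k_linear_axioms]]
  by (simp add: g0_def[abs_def] comp_def)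

lemma linear_g1: "k_linear (scale_E A) (scale_E A') g1"
  using k_linear_plus[OF tgt.algebra_E
      k_linear_plus[OF tgt.algebra_E F1.k_linear_axioms
        k_linear_compose[OF b1.k_linear_axioms linear_s]]
      k_linear_compose[OF linear_t b2'.k_linear_axioms]]
  by (simp add: g1_def[abs_def] comp_def)

lemma linear_g2: "k_linear (scale_L A) (scale_L A') g2"
  using k_linear_plus[OF tgt.algebra_L F2.k_linear_axioms
      k_linear_compose[OF b2.k_linear_axioms linear_t]]
  by (simp add: g2_def[abs_def] comp_def)

lemma g0_mult: "g0 (r * r') = g0 r * g0 r'"
  by (simp add: g0_def F0.mult s_mult b1'.add b1'.mult tgt.bd1_act algebra_simps)

text \<open>
  The action terms \<open>f\<^sub>0\<partial>\<^sub>1(e) \<triangleright> s\<partial>\<^sub>1(e')\<close> of the derivation rule for \<open>s\<close> cancel against those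
  in \<open>\<partial>\<^sub>2{s\<partial>\<^sub>1(e') \<otimes> f\<^sub>1(e)}\<close>, since \<open>\<partial>\<^sub>1f\<^sub>1 = f\<^sub>0\<partial>\<^sub>1\<close>.
\<close>

lemma g1_mult: "g1 (e * e') = g1 e * g1 e'"
  by (simp add: g1_def F1.mult b1.mult s_mult t_mult b2'.add b2'.mult
      tgt.bd2_peiffer tgt.bd2_act_EL bd1_f1 algebra_simps)

lemma g2_mult: "g2 (l * l') = g2 l * g2 l'"
  by (simp add: g2_def F2.mult b2.mult t_mult src.bd1_bd2 S.zero P.zero_left EL.zero_left
      tgt.act_EL_bd2 bd2_f2[symmetric] algebra_simps)

lemma bd2_g2: "bd2 A' (g2 l) = g1 (bd2 A l)"
  by (simp add: g1_def g2_def b2'.add bd2_f2 src.bd1_bd2 S.zero)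

lemma bd1_g1: "bd1 A' (g1 e) = g0 (bd1 A e)"
  by (simp add: g0_def g1_def b1'.add bd1_f1 tgt.bd1_bd2)

text \<open>
  The three Peiffer terms of the action rule for \<open>t\<close> carry signs such that their product parts
  and that of \<open>s(r\<partial>\<^sub>1(e))\<close> cancel. The action terms \<open>f\<^sub>0\<partial>\<^sub>1(e) \<triangleright> s(r)\<close> cancel too,
  and \<open>\<partial>\<^sub>1s(r)\<close> acting on \<open>f\<^sub>1(e) + s\<partial>\<^sub>1(e)\<close> remains.
\<close>

lemma g1_act: "g1 (act_E A r e) = act_E A' (g0 r) (g1 e)"
  by (simp add: g0_def g1_def f1_act src.bd1_act s_mult t_act b2'.add b2'.diff
      tgt.bd2_act tgt.bd2_peiffer bd1_f1 aE.add_left aE.add_right algebra_simps)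

text \<open>
  The difference \<open>{s(r) \<otimes> \<partial>\<^sub>2f\<^sub>2(l)} - {\<partial>\<^sub>2f\<^sub>2(l) \<otimes> s(r)}\<close> left over by the action rule
  for \<open>t\<close> is \<open>\<partial>\<^sub>1s(r) \<triangleright> f\<^sub>2(l)\<close>: the derived actions of \<open>s(r)\<close> cancel.
\<close>

lemma g2_act: "g2 (act_L A r l) = act_L A' (g0 r) (g2 l)"
proof -
  have "peiffer A' (s r) (bd2 A' (f2 l)) - peiffer A' (bd2 A' (f2 l)) (s r)
      = act_L A' (bd1 A' (s r)) (f2 l)"
    by (simp add: tgt.peiffer_bd2 act_EL_def)
  then show ?thesis
    by (simp add: g0_def g2_def f2_act src.bd2_act t_act src.bd1_bd2 S.zero P.zero_left
        aL.add_left aL.add_right bd2_f2 algebra_simps)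
qed

lemma g2_peiffer: "g2 (peiffer A e e') = peiffer A' (g1 e) (g1 e')"
proof -
  let ?d = "s (bd1 A e)" and ?d' = "s (bd1 A e')"
  have "g2 (peiffer A e e')
      = peiffer A' (f1 e) (f1 e') + t (e * e') - t (act_E A (bd1 A e') e)"
    by (simp add: g2_def f2_peiffer src.bd2_peiffer T.diff)
  also have "\<dots> = peiffer A' (f1 e) (f1 e') + peiffer A' (f1 e) ?d' + act_EL A' (f1 e) (t e')
      + peiffer A' ?d (f1 e') + peiffer A' ?d ?d' + act_EL A' ?d (t e')
      + (act_EL A' (f1 e') (t e) - act_L A' (bd1 A' (f1 e')) (t e))
      + (act_EL A' ?d' (t e) - act_L A' (bd1 A' ?d') (t e)) + t e * t e'"
    by (simp add: t_mult t_act bd1_f1)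
  also have "\<dots> = peiffer A' (g1 e) (g1 e')"
    by (simp add: g1_def P.add_left P.add_right tgt.peiffer_bd2 tgt.peiffer_bd2_bd2
        act_EL_def[symmetric] tgt.act_EL_bd2 EL.add_left)
  finally show ?thesis .
qed

lemma two_crossed_map_g: "two_crossed_map A A' g2 g1 g0"
  by (intro two_crossed_map.intro algebra_map.intro algebra_map_axioms.intro
      linear_g0 linear_g1 linear_g2 g0_mult g1_mult g2_mult
      bd2_g2 bd1_g1 g1_act g2_act g2_peiffer)

end

theorem theorem4p3:
  fixes A :: "('k::{comm_ring,comm_monoid_mult}, 'l::comm_ring, 'e::comm_ring, 'r::comm_ring) two_crossed"
    and A' :: "('k, 'l1::comm_ring, 'e1::comm_ring, 'r1::comm_ring) two_crossed"
    and f2 :: "'l \<Rightarrow> 'l1" and f1 :: "'e \<Rightarrow> 'e1" and f0 :: "'r \<Rightarrow> 'r1"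
    and s :: "'r \<Rightarrow> 'e1" and t :: "'e \<Rightarrow> 'l1"
  assumes "two_crossed_module A"
    and "two_crossed_module A'"
    and "two_crossed_map A A' f2 f1 f0"
    and "quadratic_derivation A A' f1 f0 s t"
  shows "two_crossed_map A A'
    (\<lambda>l. f2 l + (t \<circ> bd2 A) l)
    (\<lambda>e. f1 e + (s \<circ> bd1 A) e + (bd2 A' \<circ> t) e)
    (\<lambda>r. f0 r + (bd1 A' \<circ> s) r)"
proof -
  interpret quadratic_homotopy A A' f2 f1 f0 s t
    using assms by (rule quadratic_homotopy.intro)
  show ?thesis
    using two_crossed_map_g by (simp add: g0_def[abs_def] g1_def[abs_def] g2_def[abs_def])
qed

end
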